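(* Let $M^2\subset\mathbb{R}^3$ be a translational surface locally parametrized by $X(u,v)=(f_1(u)+f_2(v),u,v)$, with nonzero Gaussian curvature, and let $a,b\in\mathbb{R}$. Then $$N_1A_M=aX_1+b$$ if and only if there exist local coordinates $(\theta,\phi)\in\left(-\frac{\pi}{2},\frac{\pi}{2}\right)\times\left(-\frac{\pi}{2},\frac{\pi}{2}\right)$ and real constants $C_1,C_3,C_4,C_5,C_6$ such that $M^2$ is given by $$X=\begin{cases}\Big(-\frac{b}{a}+C_3\sec^a\theta+C_5\sec^a\phi,\; C_4+aC_3\Phi(\theta),\; C_6+aC_5\Phi(\phi)\Big), & a\neq 0,\\[0.6em] \Big(C_3-C_1\ln(\cos\theta)-(b-C_1)\ln(\cos\phi),\; C_4+C_1\theta,\; C_5+(b-C_1)\phi\Big), & a=0,\end{cases}$$ where $\Phi(t)=\int\sec^a t\,dt$.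
   Context: $A_M=\frac1{\kappa_1}+\frac1{\kappa_2}$ is the sum of the principal radial curvatures ($\kappa_1,\kappa_2$ the principal curvatures with respect to the unit normal $N$, with convention $N_{,i}=-\kappa_iX_{,i}$ along lines of curvature), so $A_M=2H/K$ with $H$ the mean and $K$ the Gaussian curvature. $X_1=\langle X,e_1\rangle$ is the height function and $N_1=\langle N,e_1\rangle$ the angle function; here $N=\frac{(1,-f_1',-f_2')}{\sqrt{1+f_1'^2+f_2'^2}}$, $X_1=f_1(u)+f_2(v)$, $N_1=\frac{1}{\sqrt{1+f_1'^2+f_2'^2}}$. $\int$ denotes an antiderivative. *)

theory Defs
  imports "HOL-Analysis.Analysis"
begin

section \<open>Smooth maps and smooth changes of coordinates\<close>

text \<open>Both notions are meant for open sets only. A map is \<open>C\<^sup>k\<^sup>+\<^sup>1\<close> iff it is differentiable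
  and all its directional derivatives are \<open>C\<^sup>k\<close>.\<close>

fun Ck_on :: "nat \<Rightarrow> 'a::real_normed_vector set \<Rightarrow> ('a \<Rightarrow> 'b::real_normed_vector) \<Rightarrow> bool" where
  "Ck_on 0 S f \<longleftrightarrow> continuous_on S f"
| "Ck_on (Suc k) S f \<longleftrightarrow>
     (\<forall>x\<in>S. f differentiable (at x)) \<and> (\<forall>v. Ck_on k S (\<lambda>x. frechet_derivative f (at x) v))"

definition smooth_on :: "'a::real_normed_vector set \<Rightarrow> ('a \<Rightarrow> 'b::real_normed_vector) \<Rightarrow> bool" where
  "smooth_on S f \<longleftrightarrow> (\<forall>k. Ck_on k S f)"

definition diffeomorphism ::
    "'a::real_normed_vector set \<Rightarrow> 'b::real_normed_vector set \<Rightarrow> ('a \<Rightarrow> 'b) \<Rightarrow> bool" where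
  "diffeomorphism D U \<psi> \<longleftrightarrow>
     open D \<and> open U \<and> bij_betw \<psi> D U \<and> smooth_on D \<psi> \<and> smooth_on U (inv_into D \<psi>)"

text \<open>The surface parametrized by \<open>X\<close> on \<open>U\<close> is given by \<open>Y\<close> in the coordinates
  \<open>\<psi>\<inverse>\<close>, which take values in the open set \<open>D\<close>.\<close>

definition given_in_coordinates ::
    "(real \<times> real \<Rightarrow> real^3) \<Rightarrow> (real \<times> real) set \<Rightarrow> (real \<times> real \<Rightarrow> real \<times> real)
      \<Rightarrow> (real \<times> real) set \<Rightarrow> (real \<times> real \<Rightarrow> real^3) \<Rightarrow> bool" where
  "given_in_coordinates X U \<psi> D Y \<longleftrightarrow> diffeomorphism D U \<psi> \<and> (\<forall>q\<in>D. X (\<psi> q) = Y q)"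

section \<open>Curvature of parametrized surfaces\<close>

definition unit_normal :: "(real \<times> real \<Rightarrow> real^3) \<Rightarrow> real \<times> real \<Rightarrow> real^3" where
  "unit_normal X p =
     (let n = cross3 (frechet_derivative X (at p) (1, 0)) (frechet_derivative X (at p) (0, 1))
      in n /\<^sub>R norm n)"

definition principal_direction ::
    "(real \<times> real \<Rightarrow> real^3) \<Rightarrow> real \<times> real \<Rightarrow> real \<Rightarrow> real \<times> real \<Rightarrow> bool" where
  "principal_direction X p k w \<longleftrightarrow>
     w \<noteq> 0 \<and>
     frechet_derivative (unit_normal X) (at p) w = - k *\<^sub>R frechet_derivative X (at p) w"

text \<open>The two principal curvatures, ordered by size. Requiring linearly independent principal
  directions makes the two values agree exactly at umbilic points.\<close>

definition principal_curvatures ::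
    "(real \<times> real \<Rightarrow> real^3) \<Rightarrow> real \<times> real \<Rightarrow> real \<times> real" where
  "principal_curvatures X p = (THE (k1, k2). k1 \<le> k2 \<and>
     (\<exists>w1 w2. w1 \<noteq> w2 \<and> independent {w1, w2} \<and>
        principal_direction X p k1 w1 \<and> principal_direction X p k2 w2))"

definition gauss_curvature :: "(real \<times> real \<Rightarrow> real^3) \<Rightarrow> real \<times> real \<Rightarrow> real" where
  "gauss_curvature X p = (case principal_curvatures X p of (k1, k2) \<Rightarrow> k1 * k2)"

definition radii_sum :: "(real \<times> real \<Rightarrow> real^3) \<Rightarrow> real \<times> real \<Rightarrow> real" where
  "radii_sum X p = (case principal_curvatures X p of (k1, k2) \<Rightarrow> 1 / k1 + 1 / k2)"

definition height_fun :: "(real \<times> real \<Rightarrow> real^3) \<Rightarrow> real \<times> real \<Rightarrow> real" where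
  "height_fun X p = X p \<bullet> axis 1 1"

definition angle_fun :: "(real \<times> real \<Rightarrow> real^3) \<Rightarrow> real \<times> real \<Rightarrow> real" where
  "angle_fun X p = unit_normal X p \<bullet> axis 1 1"

section \<open>Translational surfaces\<close>

definition translational :: "(real \<Rightarrow> real) \<Rightarrow> (real \<Rightarrow> real) \<Rightarrow> real \<times> real \<Rightarrow> real^3" where
  "translational f1 f2 = (\<lambda>(u, v). vector [f1 u + f2 v, u, v])"

definition sec :: "real \<Rightarrow> real" where
  "sec t = 1 / cos t"

end

theory Submission
  imports Defs
begin

text \<open>With \<open>p = f1'\<close>, \<open>q = f2'\<close>, \<open>r = f1''\<close> and \<open>t = f2''\<close>, the fundamental forms of
  \<open>X(u, v) = (f1 u + f2 v, u, v)\<close> have the matrices \<open>((1 + p\<^sup>2, p q), (p q, 1 + q\<^sup>2))\<close> and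
  \<open>diag(r, t) / W\<close>, where \<open>W\<^sup>2 = 1 + p\<^sup>2 + q\<^sup>2\<close>. Hence \<open>K\<close> is nonzero iff \<open>r\<close> and \<open>t\<close> are, and
  \<open>N\<^sub>1 A\<^sub>M = (1 + p\<^sup>2) / r + (1 + q\<^sup>2) / t\<close> (lemma \<open>angle_times_radii_sum\<close>). This is a sum of a
  function of \<open>u\<close> and a function of \<open>v\<close>, just as \<open>a X\<^sub>1 + b\<close> is.

  If the two agree, separation of variables on the connected set \<open>U\<close> gives a constant \<open>m\<close> with
  \<open>(1 + f1'\<^sup>2) / f1'' = a f1 + m\<close> and \<open>(1 + f2'\<^sup>2) / f2'' = a f2 + (b - m)\<close>. In the slope angle
  \<open>\<theta> = arctan f1'\<close> the first equation is linear: \<open>du/d\<theta> = a f1 + m\<close> and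
  \<open>df1/d\<theta> = (a f1 + m) tan \<theta>\<close>. It integrates to the stated normal form (lemma
  \<open>profile_in_angle_coordinate\<close>), and likewise for the second. The slope angles of both profiles
  are the required coordinates; they form a diffeomorphism because \<open>u\<close> and \<open>v\<close> are smooth
  functions of them (lemma \<open>diffeomorphism_angles\<close>).

  Conversely, in the given coordinates both profiles have slopes \<open>tan \<theta>\<close> and \<open>tan \<phi>\<close>. Differentiating
  once more gives \<open>(1 + f1'\<^sup>2) / f1'' = du/d\<theta>\<close> and the same for \<open>f2\<close> (lemma
  \<open>angle_coordinates_imp_ode\<close>), and the sum \<open>du/d\<theta> + dv/d\<phi>\<close> equals \<open>a X\<^sub>1 + b\<close> by the formulas for
  \<open>u\<close>, \<open>v\<close> and \<open>X\<^sub>1\<close>. Dividing by \<open>du/d\<theta>\<close> and \<open>dv/d\<phi>\<close> is legitimate because a vanishing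
  coefficient would contradict the injectivity of the coordinate change.\<close>

section \<open>Calculus of smooth maps\<close>

text \<open>The Frechet derivative at a point of an open set depends only on the values on that set; this
  is what allows a formula valid on \<open>S\<close> alone to replace the function.\<close>

lemma Ck_on_cong:
  assumes "open S" "\<And>x. x \<in> S \<Longrightarrow> f x = g x"
  shows "Ck_on k S f \<longleftrightarrow> Ck_on k S g"
  using assms(2)
proof (induction k arbitrary: f g)
  case 0
  then show ?case by (simp cong: continuous_on_cong)
next
  case (Suc k)
  have D: "(f has_derivative d) (at x) \<longleftrightarrow> (g has_derivative d) (at x)" if "x \<in> S" for x d
    using has_derivative_transform_within_open[OF _ assms(1) that, of f d UNIV g]
      has_derivative_transform_within_open[OF _ assms(1) that, of g d UNIV f] Suc.prems by auto
  have "frechet_derivative f (at x) = frechet_derivative g (at x)" if "x \<in> S" for x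
    using D[OF that] by (simp add: frechet_derivative_def)
  then have "Ck_on k S (\<lambda>x. frechet_derivative f (at x) v) \<longleftrightarrow>
             Ck_on k S (\<lambda>x. frechet_derivative g (at x) v)" for v
    by (intro Suc.IH) auto
  then show ?case using D by (auto simp: differentiable_def)
qed

text \<open>Introduction rule for the recursion step: the derivative may be any family \<open>f'\<close> given
  by a formula on \<open>S\<close>, so that no Frechet derivative has to be evaluated.\<close>

lemma Ck_on_SucI:
  assumes "open S" "\<And>x. x \<in> S \<Longrightarrow> (f has_derivative f' x) (at x)"
    and "\<And>v. Ck_on k S (\<lambda>x. f' x v)"
  shows "Ck_on (Suc k) S f"
proof -
  have "Ck_on k S (\<lambda>x. frechet_derivative f (at x) v)" for v
    using Ck_on_cong[OF assms(1), of "\<lambda>x. frechet_derivative f (at x) v" "\<lambda>x. f' x v"]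
      frechet_derivative_at[OF assms(2)] assms(3) by metis
  then show ?thesis using assms(2) by (auto simp: differentiable_def)
qed

lemma Ck_on_has_derivative:
  assumes "Ck_on (Suc k) S f" "x \<in> S"
  shows "(f has_derivative frechet_derivative f (at x)) (at x)"
  using assms frechet_derivative_works by auto

lemma Ck_on_SucD:
  "Ck_on (Suc k) S f \<Longrightarrow> Ck_on k S f"
proof (induction k arbitrary: f)
  case 0
  then show ?case
    by (auto intro!: continuous_at_imp_continuous_on differentiable_imp_continuous_within)
next
  case (Suc k)
  from Suc.prems have "Ck_on (Suc k) S (\<lambda>x. frechet_derivative f (at x) v)" for v
    unfolding Ck_on.simps(2)[of "Suc k"] by blast
  then have "Ck_on k S (\<lambda>x. frechet_derivative f (at x) v)" for v
    by (rule Suc.IH)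
  then show ?case using Suc.prems by simp
qed

lemma Ck_on_const: "open S \<Longrightarrow> Ck_on k S (\<lambda>x. c)"
proof (induction k arbitrary: c)
  case (Suc k)
  then show ?case by (intro Ck_on_SucI[where f' = "\<lambda>x v. 0"]) auto
qed simp

lemma Ck_on_add:
  assumes "open S"
  shows "Ck_on k S f \<Longrightarrow> Ck_on k S g \<Longrightarrow> Ck_on k S (\<lambda>x. f x + g x)"
proof (induction k arbitrary: f g)
  case (Suc k)
  show ?case
    by (rule Ck_on_SucI[OF assms has_derivative_add[OF Suc.prems[THEN Ck_on_has_derivative]]])
       (use Suc in auto)
qed (auto intro: continuous_intros)

lemma Ck_on_mult:
  fixes f g :: "'a::real_normed_vector \<Rightarrow> real"
  assumes "open S"
  shows "Ck_on k S f \<Longrightarrow> Ck_on k S g \<Longrightarrow> Ck_on k S (\<lambda>x. f x * g x)"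
proof (induction k arbitrary: f g)
  case (Suc k)
  show ?case
    by (rule Ck_on_SucI[OF assms has_derivative_mult[OF Suc.prems[THEN Ck_on_has_derivative]]])
       (use Suc Suc.prems[THEN Ck_on_SucD] in \<open>auto intro!: Ck_on_add assms\<close>)
qed (auto intro: continuous_intros)

lemma Ck_on_Pair:
  assumes "open S"
  shows "Ck_on k S f \<Longrightarrow> Ck_on k S g \<Longrightarrow> Ck_on k S (\<lambda>x. (f x, g x))"
proof (induction k arbitrary: f g)
  case (Suc k)
  show ?case
    by (rule Ck_on_SucI[OF assms has_derivative_Pair[OF Suc.prems[THEN Ck_on_has_derivative]]])
       (use Suc in auto)
qed (auto intro: continuous_intros)

lemma Ck_on_compose_bounded_linear:
  assumes "open T" "bounded_linear L" "L ` T \<subseteq> S"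
  shows "Ck_on k S f \<Longrightarrow> Ck_on k T (\<lambda>x. f (L x))"
proof (induction k arbitrary: f)
  case 0
  then show ?case
    using continuous_on_compose2[OF _ linear_continuous_on[OF assms(2)] assms(3), of f] by simp
next
  case (Suc k)
  have "((\<lambda>x. f (L x)) has_derivative (\<lambda>v. frechet_derivative f (at (L x)) (L v))) (at x)"
    if "x \<in> T" for x
    by (rule has_derivative_compose[OF bounded_linear_imp_has_derivative[OF assms(2)]
          Ck_on_has_derivative[OF Suc.prems]]) (use that assms(3) in auto)
  then show ?case
    by (rule Ck_on_SucI[OF assms(1)]) (use Suc in auto)
qed

lemma Ck_on_Suc_real:
  fixes f f' :: "real \<Rightarrow> real"
  assumes "open S" "\<And>x. x \<in> S \<Longrightarrow> (f has_real_derivative f' x) (at x)" "Ck_on k S f'"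
  shows "Ck_on (Suc k) S f"
proof (rule Ck_on_SucI[OF assms(1), where f' = "\<lambda>x v. f' x * v"])
  show "(f has_derivative (\<lambda>v. f' x * v)) (at x)" if "x \<in> S" for x
    using assms(2)[OF that] by (simp add: has_field_derivative_def)
  show "Ck_on k S (\<lambda>x. f' x * v)" for v
    by (rule Ck_on_mult[OF assms(1,3) Ck_on_const[OF assms(1)]])
qed

lemma smooth_on_deriv:
  fixes f :: "real \<Rightarrow> real"
  assumes "open S" "smooth_on S f"
  shows "smooth_on S (deriv f)"
    and "\<And>x. x \<in> S \<Longrightarrow> (f has_real_derivative deriv f x) (at x)"
proof -
  have *: "(f has_real_derivative deriv f x) (at x)" if "x \<in> S" for x
  proof -
    have "Ck_on 1 S f"
      using assms by (auto simp: smooth_on_def)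
    then have "f differentiable (at x)"
      using that by auto
    then show ?thesis
      by (simp add: DERIV_deriv_iff_real_differentiable)
  qed
  then show "\<And>x. x \<in> S \<Longrightarrow> (f has_real_derivative deriv f x) (at x)" .
  have "frechet_derivative f (at x) 1 = deriv f x" if "x \<in> S" for x
    using frechet_derivative_at[OF *[OF that, unfolded has_field_derivative_def]]
    by (metis mult.right_neutral)
  moreover have "Ck_on k S (\<lambda>x. frechet_derivative f (at x) 1)" for k
  proof -
    have "Ck_on (Suc k) S f"
      using assms by (auto simp: smooth_on_def)
    then show ?thesis by auto
  qed
  ultimately show "smooth_on S (deriv f)"
    unfolding smooth_on_def using Ck_on_cong[OF assms(1)] by (metis (no_types, lifting))
qed

text \<open>The derivative is \<open>g' y\<close> with \<open>y = 1 / (1 + g\<^sup>2)\<close>, and \<open>y' = - 2 g g' y\<^sup>2\<close> is a polynomial in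
  \<open>g\<close>, \<open>g'\<close> and \<open>y\<close> itself. So if \<open>y\<close> is \<open>C\<^sup>k\<close>, it is \<open>C\<^sup>k\<^sup>+\<^sup>1\<close>.\<close>

lemma smooth_on_arctan:
  fixes g :: "real \<Rightarrow> real"
  assumes "open S" "smooth_on S g"
  shows "smooth_on S (\<lambda>x. arctan (g x))"
proof -
  note dg = smooth_on_deriv[OF assms]
  have Cg: "Ck_on k S g" "Ck_on k S (deriv g)" for k
    using assms(2) dg(1) by (auto simp: smooth_on_def)
  define y where "y = (\<lambda>x. inverse (1 + (g x)\<^sup>2))"
  have pos: "1 + (g x)\<^sup>2 > 0" for x
    by (simp add: add_pos_nonneg)
  have dy: "(y has_real_derivative (- 2) * (g x * (deriv g x * (y x * y x)))) (at x)" if "x \<in> S" for x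
    unfolding y_def using pos[of x]
    by (auto intro!: derivative_eq_intros dg(2) that simp: field_simps power2_eq_square)
  have Cy: "Ck_on k S y" for k
  proof (induction k)
    case 0
    show ?case
      using dy by (auto intro!: continuous_at_imp_continuous_on DERIV_isCont)
  next
    case (Suc k)
    show ?case
      by (rule Ck_on_Suc_real[OF assms(1) dy], assumption)
         (intro Ck_on_mult Ck_on_const Suc.IH Cg assms(1))
  qed
  have da: "((\<lambda>x. arctan (g x)) has_real_derivative deriv g x * y x) (at x)" if "x \<in> S" for x
    unfolding y_def by (auto intro!: derivative_eq_intros dg(2) that)
  have "Ck_on (Suc k) S (\<lambda>x. arctan (g x))" for k
    by (rule Ck_on_Suc_real[OF assms(1) da]) (auto intro!: Ck_on_mult Cy Cg assms(1))
  then show ?thesis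
    unfolding smooth_on_def using Ck_on_SucD by blast
qed

lemma cos_pos_chart: "t \<in> {-pi/2<..<pi/2} \<Longrightarrow> cos t > 0"
  by (intro cos_gt_zero_pi) auto

lemma DERIV_sec_powr:
  assumes "t \<in> {-pi/2<..<pi/2}"
  shows "((\<lambda>t. sec t powr a) has_real_derivative a * tan t * sec t powr a) (at t)"
proof -
  have c: "cos t > 0" by (rule cos_pos_chart[OF assms])
  have "((\<lambda>t. (1 / cos t) powr a) has_real_derivative a * tan t * (1 / cos t) powr a) (at t)"
    using c
    by (auto intro!: derivative_eq_intros
        simp: tan_def powr_diff power2_eq_square field_simps)
  then show ?thesis by (simp add: sec_def)
qed

text \<open>The same bootstrapping, driven by the two differential equations \<open>tan' = 1 + tan\<^sup>2\<close> and
  \<open>(sec\<^sup>a)' = a tan sec\<^sup>a\<close>.\<close>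

lemma smooth_on_sec_powr_antiderivative:
  fixes \<Phi> :: "real \<Rightarrow> real"
  assumes "\<forall>t\<in>{-pi/2<..<pi/2}. (\<Phi> has_real_derivative sec t powr a) (at t)"
  shows "smooth_on {-pi/2<..<pi/2} \<Phi>"
proof -
  let ?S = "{-pi/2<..<pi/2::real}"
  have dtan: "(tan has_real_derivative 1 + tan t * tan t) (at t)" if "t \<in> ?S" for t
    using cos_pos_chart[OF that]
    by (auto intro!: derivative_eq_intros simp: tan_sec power2_eq_square[symmetric] power_inverse)
  have Ct: "Ck_on k ?S tan" for k
  proof (induction k)
    case 0
    show ?case
      by (auto intro!: continuous_at_imp_continuous_on DERIV_isCont[OF dtan])
  next
    case (Suc k)
    show ?case
      by (rule Ck_on_Suc_real[OF _ dtan])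
         (intro open_greaterThanLessThan Ck_on_mult Ck_on_add Ck_on_const Suc.IH | assumption)+
  qed
  have Cs: "Ck_on k ?S (\<lambda>t. sec t powr a)" for k
  proof (induction k)
    case 0
    show ?case
      by (auto intro!: continuous_at_imp_continuous_on DERIV_isCont[OF DERIV_sec_powr])
  next
    case (Suc k)
    show ?case
      by (rule Ck_on_Suc_real[OF _ DERIV_sec_powr])
         (intro open_greaterThanLessThan Ck_on_mult Ck_on_const Suc.IH Ct | assumption)+
  qed
  have "Ck_on (Suc k) ?S \<Phi>" for k
    by (rule Ck_on_Suc_real[OF _ _ Cs]) (use assms in auto)
  then show ?thesis
    unfolding smooth_on_def using Ck_on_SucD by blast
qed

section \<open>Simultaneous diagonalization of two quadratic forms\<close>

lemma independent_pair_iff: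
  "w1 \<noteq> w2 \<and> independent {w1, w2} \<longleftrightarrow> fst w1 * snd w2 - fst w2 * snd w1 \<noteq> 0"
  for w1 w2 :: "real \<times> real"
proof (cases "w2 = 0")
  case True
  then show ?thesis by (auto simp: dependent_zero)
next
  case False
  have "w1 \<in> span {w2} \<longleftrightarrow> fst w1 * snd w2 - fst w2 * snd w1 = 0"
  proof
    assume "w1 \<in> span {w2}"
    then show "fst w1 * snd w2 - fst w2 * snd w1 = 0"
      by (auto simp: span_singleton)
  next
    assume d: "fst w1 * snd w2 - fst w2 * snd w1 = 0"
    have "w1 = (fst w1 / fst w2) *\<^sub>R w2 \<or> w1 = (snd w1 / snd w2) *\<^sub>R w2"
      using d False by (auto simp: prod_eq_iff field_simps)
    then show "w1 \<in> span {w2}"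
      unfolding span_singleton by blast
  qed
  moreover have "w1 \<noteq> w2 \<and> independent {w1, w2} \<longleftrightarrow> w1 \<notin> span {w2}"
    using False by (auto simp: independent_insert span_base)
  ultimately show ?thesis by simp
qed

text \<open>Eigenvectors of the form \<open>\<alpha> x\<^sup>2 + \<beta> y\<^sup>2\<close> with respect to \<open>E x\<^sup>2 + 2 F x y + G y\<^sup>2\<close>. These are
  the shapes that the second and the first fundamental form of a translational surface
  have.\<close>

definition relative_eigenvector ::
    "real \<Rightarrow> real \<Rightarrow> real \<Rightarrow> real \<Rightarrow> real \<Rightarrow> real \<Rightarrow> real \<times> real \<Rightarrow> bool" where
  "relative_eigenvector E F G \<alpha> \<beta> k w \<longleftrightarrow>
     w \<noteq> 0 \<and> \<alpha> * fst w = k * (E * fst w + F * snd w) \<and> \<beta> * snd w = k * (F * fst w + G * snd w)"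

text \<open>Trace and determinant of the pencil, read off from an arbitrary eigenbasis. The eigenvalues
  may coincide, so comparing coefficients of the characteristic polynomial would not suffice. The
  product comes from taking determinants; the sum also needs that the two forms are
  symmetric.\<close>

lemma relative_eigenvalues_sum_prod:
  assumes "relative_eigenvector E F G \<alpha> \<beta> k1 w1" "relative_eigenvector E F G \<alpha> \<beta> k2 w2"
    and d: "fst w1 * snd w2 - fst w2 * snd w1 \<noteq> 0"
  shows "(k1 + k2) * (E * G - F\<^sup>2) = \<alpha> * G + \<beta> * E" "k1 * k2 * (E * G - F\<^sup>2) = \<alpha> * \<beta>"
proof -
  obtain x1 y1 x2 y2 where w: "w1 = (x1, y1)" "w2 = (x2, y2)"
    by (metis surj_pair)
  let ?d = "x1 * y2 - x2 * y1"
  have e: "\<alpha> * x1 = k1 * (E * x1 + F * y1)" "\<beta> * y1 = k1 * (F * x1 + G * y1)"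
       "\<alpha> * x2 = k2 * (E * x2 + F * y2)" "\<beta> * y2 = k2 * (F * x2 + G * y2)"
    using assms(1,2) by (auto simp: relative_eigenvector_def w)
  \<comment> \<open>The terms \<open>\<alpha> x1 x2\<close> and \<open>\<beta> y1 y2\<close> can be rewritten by the eigenvalue equation of either
    vector. Comparing the results removes the terms with \<open>k1 - k2\<close> from the expanded trace.\<close>
  have "x2 * (\<alpha> * x1) = x1 * (\<alpha> * x2)" "y2 * (\<beta> * y1) = y1 * (\<beta> * y2)"
    by simp_all
  then have "F * (x2 * (k1 * (E * x1 + F * y1)) - x1 * (k2 * (E * x2 + F * y2))) = 0"
    "F * (y2 * (k1 * (F * x1 + G * y1)) - y1 * (k2 * (F * x2 + G * y2))) = 0"
    unfolding e by simp_all
  moreover have "?d * (\<alpha> * G + \<beta> * E)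
      = G * y2 * (\<alpha> * x1) - G * y1 * (\<alpha> * x2) + E * x1 * (\<beta> * y2) - E * x2 * (\<beta> * y1)"
    by (simp add: algebra_simps)
  ultimately have "?d * ((k1 + k2) * (E * G - F\<^sup>2)) = ?d * (\<alpha> * G + \<beta> * E)"
    unfolding e by (simp add: algebra_simps power2_eq_square)
  then show "(k1 + k2) * (E * G - F\<^sup>2) = \<alpha> * G + \<beta> * E"
    using d w by simp
  have "(\<alpha> * x1) * (\<beta> * y2) - (\<alpha> * x2) * (\<beta> * y1) = ?d * (k1 * k2 * (E * G - F\<^sup>2))"
    unfolding e by (simp add: algebra_simps power2_eq_square)
  then have "?d * (k1 * k2 * (E * G - F\<^sup>2)) = ?d * (\<alpha> * \<beta>)"
    by (simp add: algebra_simps)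
  then show "k1 * k2 * (E * G - F\<^sup>2) = \<alpha> * \<beta>"
    using d w by simp
qed

text \<open>The hypothesis says that \<open>k\<close> is a root of the characteristic polynomial. The kernel of the
  singular matrix is found from its first row, unless that row is zero.\<close>

lemma relative_eigenvector_exists:
  assumes "(\<alpha> - k * E) * (\<beta> - k * G) = (k * F)\<^sup>2"
  shows "\<exists>w. relative_eigenvector E F G \<alpha> \<beta> k w"
proof (cases "\<alpha> - k * E = 0")
  case True
  then have "k * F = 0" using assms by simp
  with True have "relative_eigenvector E F G \<alpha> \<beta> k (1, 0)"
    by (auto simp: relative_eigenvector_def algebra_simps zero_prod_def)
  then show ?thesis by blast
next
  case False
  with assms have "relative_eigenvector E F G \<alpha> \<beta> k (k * F, \<alpha> - k * E)"
    by (auto simp: relative_eigenvector_def algebra_simps zero_prod_def power2_eq_square)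
  then show ?thesis by blast
qed

lemma relative_eigenvectors_independent:
  assumes "relative_eigenvector E F G \<alpha> \<beta> k1 w1" "relative_eigenvector E F G \<alpha> \<beta> k2 w2"
    and "k1 \<noteq> k2" "E * G - F\<^sup>2 \<noteq> 0"
  shows "fst w1 * snd w2 - fst w2 * snd w1 \<noteq> 0"
proof
  assume 0: "fst w1 * snd w2 - fst w2 * snd w1 = 0"
  obtain x1 y1 x2 y2 where w: "w1 = (x1, y1)" "w2 = (x2, y2)"
    by (metis surj_pair)
  have e: "\<alpha> * x1 = k1 * (E * x1 + F * y1)" "\<beta> * y1 = k1 * (F * x1 + G * y1)"
       "\<alpha> * x2 = k2 * (E * x2 + F * y2)" "\<beta> * y2 = k2 * (F * x2 + G * y2)"
       "x1 * y2 - x2 * y1 = 0"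
    using assms(1,2) 0 by (auto simp: relative_eigenvector_def w)
  have n1: "x1 \<noteq> 0 \<or> y1 \<noteq> 0" and n2: "x2 \<noteq> 0 \<or> y2 \<noteq> 0"
    using assms(1,2) by (auto simp: relative_eigenvector_def w zero_prod_def)
  obtain c where c: "x2 = c * x1" "y2 = c * y1" "c \<noteq> 0"
  proof (cases "x1 = 0")
    case True
    then show ?thesis using that[of "y2 / y1"] n1 n2 e(5) by auto
  next
    case False
    then have "y2 = x2 / x1 * y1" using e(5) by (simp add: field_simps)
    then show ?thesis using that[of "x2 / x1"] n2 False by auto
  qed
  have "c * ((k1 - k2) * (E * x1 + F * y1)) = 0" "c * ((k1 - k2) * (F * x1 + G * y1)) = 0"
    using e(1-4) c(1,2) by algebra+
  then have "E * x1 + F * y1 = 0" "F * x1 + G * y1 = 0"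
    using c(3) assms(3) by auto
  then have "(E * G - F\<^sup>2) * x1 = 0" "(E * G - F\<^sup>2) * y1 = 0"
    by algebra+
  then show False using n1 assms(4) by simp
qed

text \<open>The discriminant \<open>\<Delta>\<close> of the characteristic polynomial has two expressions, as
  \<open>B\<^sup>2 - 4 A \<alpha> \<beta>\<close> and as \<open>(\<alpha> G - \<beta> E)\<^sup>2 + 4 F\<^sup>2 \<alpha> \<beta>\<close>. According to the sign of \<open>\<alpha> \<beta>\<close> one of
  them shows \<open>\<Delta> \<ge> 0\<close>. If \<open>\<Delta>\<close> vanishes, the second one forces the two forms to be
  proportional, and then every vector is an eigenvector.\<close>

lemma relative_eigenbasis_exists:
  assumes pos: "E > 0" "G > 0" "E * G - F\<^sup>2 > 0"
  shows "\<exists>k1 k2 w1 w2. k1 \<le> k2 \<and> fst w1 * snd w2 - fst w2 * snd w1 \<noteq> 0 \<and>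
    relative_eigenvector E F G \<alpha> \<beta> k1 w1 \<and> relative_eigenvector E F G \<alpha> \<beta> k2 w2"
proof -
  define A B where "A = E * G - F\<^sup>2" and "B = \<alpha> * G + \<beta> * E"
  define \<Delta> where "\<Delta> = B\<^sup>2 - 4 * A * (\<alpha> * \<beta>)"
  have D: "\<Delta> = (\<alpha> * G - \<beta> * E)\<^sup>2 + 4 * F\<^sup>2 * (\<alpha> * \<beta>)"
    unfolding \<Delta>_def A_def B_def by (simp add: power2_eq_square algebra_simps)
  have A: "A > 0" using pos by (simp add: A_def)
  show ?thesis
  proof (cases "\<Delta> > 0")
    case True
    \<comment> \<open>the roots of \<open>A k\<^sup>2 - B k + \<alpha> \<beta>\<close>\<close>
    define k1 k2 where "k1 = (B - sqrt \<Delta>) / (2 * A)" and "k2 = (B + sqrt \<Delta>) / (2 * A)"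
    have "k1 < k2" unfolding k1_def k2_def using True A by (simp add: divide_strict_right_mono)
    have root: "(\<alpha> - k * E) * (\<beta> - k * G) = (k * F)\<^sup>2" if "2 * A * k = B + s" "s\<^sup>2 = \<Delta>" for k s
    proof -
      have "(2 * A * k - B)\<^sup>2 = B\<^sup>2 - 4 * A * (\<alpha> * \<beta>)" using that by (simp add: \<Delta>_def)
      then have "4 * A * (A * k\<^sup>2 - B * k + \<alpha> * \<beta>) = 0"
        by (simp add: power2_eq_square algebra_simps)
      then have "A * k\<^sup>2 - B * k + \<alpha> * \<beta> = 0" using A by simp
      then show ?thesis unfolding A_def B_def by (simp add: power2_eq_square algebra_simps)
    qed
    have "(\<alpha> - k1 * E) * (\<beta> - k1 * G) = (k1 * F)\<^sup>2"
      by (rule root[of _ "- sqrt \<Delta>"]) (use True A in \<open>auto simp: k1_def\<close>)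
    moreover have "(\<alpha> - k2 * E) * (\<beta> - k2 * G) = (k2 * F)\<^sup>2"
      by (rule root[of _ "sqrt \<Delta>"]) (use True A in \<open>auto simp: k2_def\<close>)
    ultimately obtain w1 w2 where
      "relative_eigenvector E F G \<alpha> \<beta> k1 w1" "relative_eigenvector E F G \<alpha> \<beta> k2 w2"
      using relative_eigenvector_exists by metis
    with relative_eigenvectors_independent[OF this] \<open>k1 < k2\<close> A show ?thesis
      unfolding A_def by (metis less_imp_le less_irrefl)
  next
    case False
    have "\<alpha> * \<beta> \<ge> 0"
    proof (rule ccontr)
      assume "\<not> ?thesis"
      then have "\<alpha> * \<beta> < 0" by simp
      then have "A * (\<alpha> * \<beta>) < 0" using A by (simp add: mult_pos_neg)
      moreover have "\<Delta> = B\<^sup>2 - 4 * (A * (\<alpha> * \<beta>))" by (simp add: \<Delta>_def)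
      ultimately show False using False zero_le_power2[of B] by linarith
    qed
    then have "F\<^sup>2 * (\<alpha> * \<beta>) \<ge> 0" by simp
    moreover have "\<Delta> = (\<alpha> * G - \<beta> * E)\<^sup>2 + 4 * (F\<^sup>2 * (\<alpha> * \<beta>))" by (simp add: D)
    ultimately have "(\<alpha> * G - \<beta> * E)\<^sup>2 = 0" and 2: "F\<^sup>2 * (\<alpha> * \<beta>) = 0"
      using False zero_le_power2[of "\<alpha> * G - \<beta> * E"] by linarith+
    then have 1: "\<alpha> * G - \<beta> * E = 0" by simp
    have "relative_eigenvector E F G \<alpha> \<beta> (\<alpha> / E) (1, 0)"
         "relative_eigenvector E F G \<alpha> \<beta> (\<alpha> / E) (0, 1)"
      using 1 2 pos by (auto simp: relative_eigenvector_def field_simps zero_prod_def)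
    then show ?thesis by force
  qed
qed

section \<open>Curvature of a translational surface\<close>

lemma translational_eq:
  "translational f1 f2 x =
     (f1 (fst x) + f2 (snd x)) *\<^sub>R axis 1 1 + fst x *\<^sub>R axis 2 1 + snd x *\<^sub>R axis 3 1"
  by (cases x) (simp add: translational_def vec_eq_iff forall_3 axis_def)

text \<open>The letters \<open>p\<close>, \<open>q\<close>, \<open>r\<close>, \<open>t\<close> are Monge's notation for the first and the pure second
  partial derivatives of the height; its mixed second derivative vanishes identically because the
  variables are separated. The normal vector \<open>(1, -p, -q)\<close> has length \<open>W\<close>.\<close>

locale smooth_translational_surface =
  fixes U :: "(real \<times> real) set" and f1 f2 :: "real \<Rightarrow> real"
  assumes open_U: "open U"
    and smooth_f1: "smooth_on (fst ` U) f1" and smooth_f2: "smooth_on (snd ` U) f2"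
begin

abbreviation "p \<equiv> deriv f1"
abbreviation "q \<equiv> deriv f2"
abbreviation "r \<equiv> deriv p"
abbreviation "t \<equiv> deriv q"
abbreviation "X \<equiv> translational f1 f2"
abbreviation W :: "real \<times> real \<Rightarrow> real" where
  "W x \<equiv> sqrt (1 + (p (fst x))\<^sup>2 + (q (snd x))\<^sup>2)"

lemma open_fst_U: "open (fst ` U)" and open_snd_U: "open (snd ` U)"
  using open_U by (auto intro: open_image_fst open_image_snd)

lemma smooth_p: "smooth_on (fst ` U) p" and smooth_q: "smooth_on (snd ` U) q"
  using smooth_on_deriv(1) open_fst_U open_snd_U smooth_f1 smooth_f2 by auto

lemma DERIV_profiles:
  assumes "x \<in> U"
  shows "(f1 has_real_derivative p (fst x)) (at (fst x))"
    and "(f2 has_real_derivative q (snd x)) (at (snd x))"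
    and "(p has_real_derivative r (fst x)) (at (fst x))"
    and "(q has_real_derivative t (snd x)) (at (snd x))"
  using assms smooth_on_deriv(2)[OF open_fst_U] smooth_on_deriv(2)[OF open_snd_U]
    smooth_f1 smooth_f2 smooth_p smooth_q by auto

lemma has_derivative_profiles:
  assumes "x \<in> U"
  shows "((\<lambda>y. f1 (fst y)) has_derivative (\<lambda>w. p (fst x) * fst w)) (at x)"
    and "((\<lambda>y. f2 (snd y)) has_derivative (\<lambda>w. q (snd x) * snd w)) (at x)"
    and "((\<lambda>y. p (fst y)) has_derivative (\<lambda>w. r (fst x) * fst w)) (at x)"
    and "((\<lambda>y. q (snd y)) has_derivative (\<lambda>w. t (snd x) * snd w)) (at x)"
  using DERIV_profiles[OF assms, unfolded has_field_derivative_def]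
    has_derivative_compose[OF has_derivative_fst[OF has_derivative_ident]]
    has_derivative_compose[OF has_derivative_snd[OF has_derivative_ident]] by blast+

lemma frechet_derivative_X:
  assumes "x \<in> U"
  shows "frechet_derivative X (at x) w =
    vector [p (fst x) * fst w + q (snd x) * snd w, fst w, snd w]"
proof -
  have *: "(X has_derivative (\<lambda>w. vector [p (fst x) * fst w + q (snd x) * snd w, fst w, snd w])) (at x)"
    unfolding translational_eq[abs_def]
    by (rule has_derivative_eq_rhs[OF has_derivative_add[OF has_derivative_add[OF
          has_derivative_scaleR_left[OF has_derivative_add[OF has_derivative_profiles(1,2)[OF assms]]]
          has_derivative_scaleR_left[OF has_derivative_fst[OF has_derivative_ident]]]
          has_derivative_scaleR_left[OF has_derivative_snd[OF has_derivative_ident]]]])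
       (simp add: fun_eq_iff vec_eq_iff forall_3 axis_def)
  show ?thesis by (rule fun_cong[OF frechet_derivative_at[OF *, symmetric]])
qed

lemma W_pos: "W x > 0" and W_sqr: "(W x)\<^sup>2 = 1 + (p (fst x))\<^sup>2 + (q (snd x))\<^sup>2"
  by (simp_all add: add_pos_nonneg)

lemma unit_normal_X:
  assumes "x \<in> U"
  shows "unit_normal X x = (1 / W x) *\<^sub>R vector [1, - p (fst x), - q (snd x)]"
proof -
  have "cross3 (frechet_derivative X (at x) (1, 0)) (frechet_derivative X (at x) (0, 1))
     = vector [1, - p (fst x), - q (snd x)]"
    by (simp add: frechet_derivative_X[OF assms] cross3_def)
  moreover have "norm (vector [1, - p (fst x), - q (snd x)] :: real^3) = W x"
    by (simp add: norm_eq_sqrt_inner inner_vec_def sum_3 power2_eq_square)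
  ultimately show ?thesis
    by (simp add: unit_normal_def Let_def inverse_eq_divide)
qed

lemma frechet_derivative_unit_normal:
  assumes "x \<in> U"
  defines "e \<equiv> \<lambda>w. - (p (fst x) * r (fst x) * fst w + q (snd x) * t (snd x) * snd w) / W x ^ 3"
  shows "frechet_derivative (unit_normal X) (at x) w =
    vector [e w, - r (fst x) * fst w / W x - p (fst x) * e w,
            - t (snd x) * snd w / W x - q (snd x) * e w]"
proof -
  let ?d = "\<lambda>w. vector [e w, - r (fst x) * fst w / W x - p (fst x) * e w,
            - t (snd x) * snd w / W x - q (snd x) * e w] :: real^3"
  define \<omega> where "\<omega> = (\<lambda>x. 1 / W x)"
  let ?N = "\<lambda>x. \<omega> x *\<^sub>R (axis 1 1 - p (fst x) *\<^sub>R axis 2 1 - q (snd x) *\<^sub>R axis 3 1) :: real^3"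
  have "((\<lambda>s. 1 / sqrt s) has_real_derivative - 1 / (2 * sqrt s ^ 3)) (at s)" if "s > 0" for s :: real
    using that by (auto intro!: derivative_eq_intros simp: field_simps power3_eq_cube)
  note d = this[unfolded has_field_derivative_def]
  have d': "((\<lambda>y. 1 + (p (fst y))\<^sup>2 + (q (snd y))\<^sup>2) has_derivative
      (\<lambda>w. 2 * p (fst x) * (r (fst x) * fst w) + 2 * q (snd x) * (t (snd x) * snd w))) (at x)"
    by (rule has_derivative_eq_rhs[OF has_derivative_add[OF has_derivative_add[OF
          has_derivative_const has_derivative_power[OF has_derivative_profiles(3)[OF assms(1)]]]
          has_derivative_power[OF has_derivative_profiles(4)[OF assms(1)]]]])
       (simp add: fun_eq_iff algebra_simps)
  have "(\<omega> has_derivative (\<lambda>w. - 1 / (2 * W x ^ 3) *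
      (2 * p (fst x) * (r (fst x) * fst w) + 2 * q (snd x) * (t (snd x) * snd w)))) (at x)"
    unfolding \<omega>_def by (rule has_derivative_compose[OF d' d]) (simp add: add_pos_nonneg)
  moreover have "(\<lambda>w. - 1 / (2 * W x ^ 3) *
      (2 * p (fst x) * (r (fst x) * fst w) + 2 * q (snd x) * (t (snd x) * snd w))) = e"
    unfolding e_def by (rule ext) (simp add: algebra_simps add_divide_distrib diff_divide_distrib)
  ultimately have \<omega>: "(\<omega> has_derivative e) (at x)" by simp
  have "(?N has_derivative ?d) (at x)"
    by (rule has_derivative_eq_rhs[OF has_derivative_scaleR[OF \<omega>
          has_derivative_diff[OF has_derivative_diff[OF has_derivative_const
            has_derivative_scaleR_left[OF has_derivative_profiles(3)[OF assms(1)]]]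
            has_derivative_scaleR_left[OF has_derivative_profiles(4)[OF assms(1)]]]]])
       (simp add: fun_eq_iff vec_eq_iff forall_3 axis_def \<omega>_def)
  moreover have "?N y = unit_normal X y" if "y \<in> U" for y
    using that by (simp add: unit_normal_X vec_eq_iff forall_3 axis_def \<omega>_def)
  ultimately have *: "(unit_normal X has_derivative ?d) (at x)"
    using has_derivative_transform_within_open[OF _ open_U assms(1)] by blast
  show ?thesis by (rule fun_cong[OF frechet_derivative_at[OF *, symmetric]])
qed

text \<open>The first component of \<open>dN = - k dX\<close> expresses the derivative \<open>e\<close> of \<open>1 / W\<close>, and substituting
  it into the other two components gives the eigenvalue equation of the second fundamental form
  with respect to the first. Conversely, the eigenvalue equation implies the first component,
  because both sides of \<open>dN = - k dX\<close> are tangential.\<close>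

lemma principal_direction_iff:
  assumes "x \<in> U"
  shows "principal_direction X x k w \<longleftrightarrow>
    relative_eigenvector (1 + (p (fst x))\<^sup>2) (p (fst x) * q (snd x)) (1 + (q (snd x))\<^sup>2)
      (r (fst x) / W x) (t (snd x) / W x) k w"
proof -
  define P Q R T V a b where "P = p (fst x)" and "Q = q (snd x)" and "R = r (fst x) / W x"
    and "T = t (snd x) / W x" and "V = W x" and "a = fst w" and "b = snd w"
  define e where "e = - (P * R * a + Q * T * b) / V\<^sup>2"
  have V: "V > 0" "V\<^sup>2 = 1 + P\<^sup>2 + Q\<^sup>2" "r (fst x) = R * V" "t (snd x) = T * V"
    using W_pos[of x] W_sqr[of x] by (auto simp: V_def P_def Q_def R_def T_def)
  have e': "e * (1 + P\<^sup>2 + Q\<^sup>2) = - (P * R * a + Q * T * b)"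
    using V by (simp add: e_def flip: V(2))
  have nz: "1 + P\<^sup>2 + Q\<^sup>2 \<noteq> 0" using V by (simp flip: V(2))
  have ee: "- (p (fst x) * r (fst x) * fst w + q (snd x) * t (snd x) * snd w) / W x ^ 3 = e"
    unfolding V(3,4) V_def[symmetric] e_def using V(1)
    by (simp add: P_def Q_def a_def b_def field_simps power2_eq_square power3_eq_cube)
  have "principal_direction X x k w \<longleftrightarrow> w \<noteq> 0 \<and>
     (e = - k * (P * a + Q * b) \<and> - R * a - P * e = - k * a \<and> - T * b - Q * e = - k * b)"
    unfolding principal_direction_def frechet_derivative_X[OF assms]
      frechet_derivative_unit_normal[OF assms] ee
    by (auto simp: vec_eq_iff forall_3 R_def T_def a_def b_def P_def Q_def)
  also have "(e = - k * (P * a + Q * b) \<and> - R * a - P * e = - k * a \<and> - T * b - Q * e = - k * b)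
    \<longleftrightarrow> R * a = k * ((1 + P\<^sup>2) * a + P * Q * b) \<and> T * b = k * (P * Q * a + (1 + Q\<^sup>2) * b)"
    (is "?L \<longleftrightarrow> ?R")
  proof
    assume ?L
    then show ?R by algebra
  next
    assume R: ?R
    have "(e + k * (P * a + Q * b)) * (1 + P\<^sup>2 + Q\<^sup>2) = 0"
      using R e' by algebra
    then have "e = - k * (P * a + Q * b)" using nz by simp
    then show ?L using R by algebra
  qed
  finally show ?thesis
    by (simp add: relative_eigenvector_def R_def T_def a_def b_def P_def Q_def)
qed

text \<open>Since the sum and the product of an ordered pair determine it, the pair of principal
  curvatures is well defined, and \<open>2 H\<close> and \<open>K\<close> are the trace and the determinant of the pencil
  of fundamental forms.\<close>

lemma principal_curvatures_sum_prod:
  assumes "x \<in> U"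
  defines "k \<equiv> principal_curvatures X x"
  shows "(fst k + snd k) * (W x)\<^sup>2 =
      r (fst x) / W x * (1 + (q (snd x))\<^sup>2) + t (snd x) / W x * (1 + (p (fst x))\<^sup>2)"
    and "fst k * snd k * (W x)\<^sup>2 = r (fst x) / W x * (t (snd x) / W x)"
proof -
  let ?E = "1 + (p (fst x))\<^sup>2" and ?F = "p (fst x) * q (snd x)" and ?G = "1 + (q (snd x))\<^sup>2"
  let ?\<alpha> = "r (fst x) / W x" and ?\<beta> = "t (snd x) / W x"
  let ?P = "\<lambda>k1 k2. k1 \<le> k2 \<and> (\<exists>w1 w2. w1 \<noteq> w2 \<and> independent {w1, w2} \<and>
        principal_direction X x k1 w1 \<and> principal_direction X x k2 w2)"
  have EG: "?E * ?G - ?F\<^sup>2 = (W x)\<^sup>2"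
    unfolding W_sqr by (simp add: power2_eq_square algebra_simps)
  have P: "?P k1 k2 \<longleftrightarrow> k1 \<le> k2 \<and> (\<exists>w1 w2. fst w1 * snd w2 - fst w2 * snd w1 \<noteq> 0 \<and>
     relative_eigenvector ?E ?F ?G ?\<alpha> ?\<beta> k1 w1 \<and> relative_eigenvector ?E ?F ?G ?\<alpha> ?\<beta> k2 w2)" for k1 k2
    unfolding principal_direction_iff[OF assms(1)] independent_pair_iff[symmetric] by blast
  have vieta: "(k1 + k2) * (W x)\<^sup>2 = ?\<alpha> * ?G + ?\<beta> * ?E" "k1 * k2 * (W x)\<^sup>2 = ?\<alpha> * ?\<beta>"
    if "?P k1 k2" for k1 k2
    using relative_eigenvalues_sum_prod[of ?E ?F ?G ?\<alpha> ?\<beta> k1 _ k2] that[unfolded P]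
    unfolding EG by blast+
  have "?E > 0" "?G > 0" "?E * ?G - ?F\<^sup>2 > 0"
    using W_pos[of x] unfolding EG by (auto intro: add_pos_nonneg)
  from relative_eigenbasis_exists[OF this, of ?\<alpha> ?\<beta>]
  obtain k1 k2 where k12: "?P k1 k2"
    unfolding P by blast
  have "k = (k1, k2)"
    unfolding k_def principal_curvatures_def
  proof (rule the_equality)
    show "case (k1, k2) of (k1, k2) \<Rightarrow> ?P k1 k2" using k12 by simp
  next
    fix l assume "case l of (k1, k2) \<Rightarrow> ?P k1 k2"
    moreover obtain l1 l2 where l1: "l = (l1, l2)" by (cases l)
    ultimately have l: "l = (l1, l2)" "?P l1 l2" by simp_all
    have W: "(W x)\<^sup>2 \<noteq> 0" using W_pos[of x] by simp
    have s: "l1 + l2 = k1 + k2" and m: "l1 * l2 = k1 * k2"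
      using vieta[OF l(2)] vieta[OF k12] W by (metis mult_cancel_right)+
    have "(l2 - l1)\<^sup>2 = (l1 + l2)\<^sup>2 - 4 * (l1 * l2)" "(k2 - k1)\<^sup>2 = (k1 + k2)\<^sup>2 - 4 * (k1 * k2)"
      by (simp_all add: power2_eq_square algebra_simps)
    then have "(l2 - l1)\<^sup>2 = (k2 - k1)\<^sup>2" using s m by simp
    then have "l2 - l1 = k2 - k1"
      using l(2) k12 by (simp add: power2_eq_iff_nonneg)
    with s show "l = (k1, k2)" by (simp add: l(1))
  qed
  then show "(fst k + snd k) * (W x)\<^sup>2 = ?\<alpha> * ?G + ?\<beta> * ?E"
    "fst k * snd k * (W x)\<^sup>2 = ?\<alpha> * ?\<beta>"
    using vieta[OF k12] by auto
qed

lemma gauss_curvature_nonzero_iff: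
  assumes "x \<in> U"
  shows "gauss_curvature X x \<noteq> 0 \<longleftrightarrow> r (fst x) \<noteq> 0 \<and> t (snd x) \<noteq> 0"
  using principal_curvatures_sum_prod(2)[OF assms] W_pos[of x]
  by (auto simp: gauss_curvature_def split_beta)

text \<open>The factor \<open>N\<^sub>1 = 1 / W\<close> cancels the \<open>W\<close> in \<open>2 H / K\<close>, and the result is a function of \<open>u\<close>
  plus a function of \<open>v\<close>. Everything else rests on this.\<close>

lemma angle_times_radii_sum:
  assumes "x \<in> U" "r (fst x) \<noteq> 0" "t (snd x) \<noteq> 0"
  shows "angle_fun X x * radii_sum X x =
    (1 + (p (fst x))\<^sup>2) / r (fst x) + (1 + (q (snd x))\<^sup>2) / t (snd x)"
proof -
  define k1 k2 where "k1 = fst (principal_curvatures X x)" and "k2 = snd (principal_curvatures X x)"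
  define E G R T V where "E = 1 + (p (fst x))\<^sup>2" and "G = 1 + (q (snd x))\<^sup>2"
    and "R = r (fst x)" and "T = t (snd x)" and "V = W x"
  have V: "V > 0" using W_pos[of x] by (simp add: V_def)
  have RT: "R \<noteq> 0" "T \<noteq> 0" using assms by (auto simp: R_def T_def)
  have s: "(k1 + k2) * V\<^sup>2 = R / V * G + T / V * E" and m: "k1 * k2 * V\<^sup>2 = R / V * (T / V)"
    using principal_curvatures_sum_prod[OF assms(1)]
    unfolding k1_def k2_def V_def E_def G_def R_def T_def by blast+
  have nz: "k1 \<noteq> 0" "k2 \<noteq> 0" using m RT V by auto
  have "1 / k1 + 1 / k2 = ((k1 + k2) * V\<^sup>2) / (k1 * k2 * V\<^sup>2)"
    using nz V by (simp add: field_simps)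
  also have "\<dots> = V * (E / R + G / T)"
    unfolding s m using V RT by (simp add: field_simps)
  finally have "1 / V * (1 / k1 + 1 / k2) = E / R + G / T"
    using V by simp
  moreover have "angle_fun X x = 1 / V"
    by (simp add: angle_fun_def unit_normal_X[OF assms(1)] inner_axis V_def)
  ultimately show ?thesis
    by (simp add: radii_sum_def split_beta k1_def k2_def E_def G_def R_def T_def)
qed

end

section \<open>Profile curves in the angle coordinate\<close>

lemma DERIV_zero_imp_constant:
  fixes g :: "real \<Rightarrow> real"
  assumes "open I" "connected I" "\<And>u. u \<in> I \<Longrightarrow> (g has_real_derivative 0) (at u)"
  shows "\<exists>c. \<forall>u\<in>I. g u = c"
proof -
  have "continuous_on I g"
    using assms(3) by (auto intro!: continuous_at_imp_continuous_on DERIV_isCont)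
  then obtain c where "\<And>u. u \<in> I \<Longrightarrow> g u = c"
    using DERIV_zero_connected_constant[OF assms(2,1), of "{}" g] assms(3) by auto
  then show ?thesis by blast
qed

text \<open>The angle coordinate is \<open>\<tau> = arctan f'\<close>. Along a solution \<open>\<tau>' = f'' / (1 + f'\<^sup>2)\<close> is the
  reciprocal of \<open>y = a f + m\<close>, which makes the equation linear in \<open>\<tau>\<close>:
  \<open>dy/d\<tau> = a y tan \<tau>\<close> and \<open>du/d\<tau> = y\<close>. So \<open>y\<close> is a multiple of \<open>sec\<^sup>a \<tau>\<close>, and \<open>u\<close> is the
  same multiple of the antiderivative, up to a constant. For \<open>a = 0\<close> the function \<open>y\<close> is the constant
  \<open>m\<close> and \<open>df/d\<tau> = m tan \<tau>\<close>. Each integration is the remark that a quotient or a difference has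
  derivative zero on an interval.\<close>

lemma profile_in_angle_coordinate:
  fixes f p r :: "real \<Rightarrow> real"
  assumes I: "open I" "connected I"
    and df: "\<And>u. u \<in> I \<Longrightarrow> (f has_real_derivative p u) (at u)"
    and dp: "\<And>u. u \<in> I \<Longrightarrow> (p has_real_derivative r u) (at u)"
    and r: "\<And>u. u \<in> I \<Longrightarrow> r u \<noteq> 0"
    and ode: "\<And>u. u \<in> I \<Longrightarrow> (1 + (p u)\<^sup>2) / r u = a * f u + m"
    and \<Phi>: "\<forall>t\<in>{-pi/2<..<pi/2}. (\<Phi> has_real_derivative sec t powr a) (at t)"
  shows "a \<noteq> 0 \<Longrightarrow> \<exists>C C'. \<forall>u\<in>I. f u = - m / a + C * sec (arctan (p u)) powr a \<and>
           u = C' + a * C * \<Phi> (arctan (p u))"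
    and "a = 0 \<Longrightarrow> \<exists>C C'. \<forall>u\<in>I. f u = C - m * ln (cos (arctan (p u))) \<and>
           u = C' + m * arctan (p u)"
proof -
  define y where "y = (\<lambda>u. a * f u + m)"
  define \<tau> where "\<tau> = (\<lambda>u. arctan (p u))"
  have \<tau>: "\<tau> u \<in> {-pi/2<..<pi/2}" "tan (\<tau> u) = p u" for u
    using arctan_bounded[of "p u"] by (auto simp: \<tau>_def tan_arctan)
  have pos: "1 + (p u)\<^sup>2 > 0" for u by (simp add: add_pos_nonneg)
  have y0: "y u \<noteq> 0" if "u \<in> I" for u
    using ode[OF that] r[OF that] pos[of u] by (auto simp: y_def)
  have d\<tau>: "(\<tau> has_real_derivative 1 / y u) (at u)" if "u \<in> I" for u
  proof -
    have "(\<tau> has_real_derivative inverse (1 + (p u)\<^sup>2) * r u) (at u)"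
      unfolding \<tau>_def by (rule DERIV_chain2[OF DERIV_arctan dp[OF that]])
    moreover have "1 + (p u)\<^sup>2 = y u * r u"
      using ode[OF that] r[OF that] by (simp add: y_def nonzero_divide_eq_eq)
    then have "inverse (1 + (p u)\<^sup>2) * r u = 1 / y u"
      using y0[OF that] r[OF that] by (simp add: field_simps)
    ultimately show ?thesis by simp
  qed
  show "\<exists>C C'. \<forall>u\<in>I. f u = - m / a + C * sec (arctan (p u)) powr a \<and>
           u = C' + a * C * \<Phi> (arctan (p u))" if a: "a \<noteq> 0"
  proof -
    define s where "s = (\<lambda>u. sec (\<tau> u) powr a)"
    have s_pos: "s u > 0" for u
      using cos_pos_chart[OF \<tau>(1)[of u]] by (simp add: s_def sec_def)
    have ds: "(s has_real_derivative a * p u * s u * (1 / y u)) (at u)" if "u \<in> I" for u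
      using DERIV_chain2[OF DERIV_sec_powr[OF \<tau>(1)] d\<tau>[OF that], of a]
      by (simp add: s_def \<tau>(2))
    have "((\<lambda>u. y u / s u) has_real_derivative 0) (at u)" if "u \<in> I" for u
    proof -
      have "(y has_real_derivative a * p u) (at u)"
        unfolding y_def by (auto intro!: derivative_eq_intros df that)
      from DERIV_divide[OF this ds[OF that]] s_pos[of u] y0[OF that] show ?thesis by simp
    qed
    then obtain c where "\<forall>u\<in>I. y u / s u = c"
      using DERIV_zero_imp_constant[OF I] by blast
    then have c: "y u = c * s u" if "u \<in> I" for u
      using s_pos[of u] that by (auto simp: field_simps)
    have "((\<lambda>u. u - c * \<Phi> (\<tau> u)) has_real_derivative 0) (at u)" if "u \<in> I" for u
    proof -
      have "((\<lambda>u. \<Phi> (\<tau> u)) has_real_derivative s u * (1 / y u)) (at u)"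
        unfolding s_def by (rule DERIV_chain2[OF \<Phi>[rule_format, OF \<tau>(1)] d\<tau>[OF that]])
      then have "((\<lambda>u. u - c * \<Phi> (\<tau> u)) has_real_derivative 1 - c * (s u * (1 / y u))) (at u)"
        by (intro DERIV_diff DERIV_ident DERIV_cmult)
      moreover have "1 - c * (s u * (1 / y u)) = 0"
        using c[OF that] y0[OF that] by simp
      ultimately show ?thesis by (simp only:)
    qed
    then obtain C' where "\<forall>u\<in>I. u - c * \<Phi> (\<tau> u) = C'"
      using DERIV_zero_imp_constant[OF I] by blast
    with c a have "\<forall>u\<in>I. f u = - m / a + c / a * s u \<and> u = C' + a * (c / a) * \<Phi> (\<tau> u)"
      by (auto simp: y_def field_simps)
    then show ?thesis unfolding s_def \<tau>_def by blast
  qed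
  show "\<exists>C C'. \<forall>u\<in>I. f u = C - m * ln (cos (arctan (p u))) \<and> u = C' + m * arctan (p u)"
    if a: "a = 0"
  proof -
    have ym: "y u = m" for u by (simp add: y_def a)
    have d\<tau>': "(\<tau> has_real_derivative 1 / m) (at u)" and m: "m \<noteq> 0" if "u \<in> I" for u
      using d\<tau>[OF that] y0[OF that] by (simp_all add: ym)
    have "((\<lambda>u. f u + m * ln (cos (\<tau> u))) has_real_derivative 0) (at u)" if "u \<in> I" for u
    proof -
      have "((\<lambda>u. f u + m * ln (cos (\<tau> u))) has_real_derivative
          p u + m * (1 / cos (\<tau> u) * (- sin (\<tau> u) * (1 / m)))) (at u)"
        by (intro DERIV_add df[OF that] DERIV_cmult DERIV_chain2[OF DERIV_ln_divide]
            DERIV_chain2[OF DERIV_cos] d\<tau>'[OF that] cos_pos_chart \<tau>(1))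
      moreover have "m * (1 / cos (\<tau> u) * (- sin (\<tau> u) * (1 / m))) = - tan (\<tau> u)"
        using m[OF that] by (simp add: tan_def)
      ultimately show ?thesis by (simp add: \<tau>(2))
    qed
    then obtain C where "\<forall>u\<in>I. f u + m * ln (cos (\<tau> u)) = C"
      using DERIV_zero_imp_constant[OF I] by blast
    moreover have "((\<lambda>u. u - m * \<tau> u) has_real_derivative 0) (at u)" if "u \<in> I" for u
    proof -
      have "((\<lambda>u. u - m * \<tau> u) has_real_derivative 1 - m * (1 / m)) (at u)"
        by (intro DERIV_diff DERIV_ident DERIV_cmult d\<tau>'[OF that])
      then show ?thesis using m[OF that] by simp
    qed
    then obtain C' where "\<forall>u\<in>I. u - m * \<tau> u = C'"
      using DERIV_zero_imp_constant[OF I] by blast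
    ultimately have "\<forall>u\<in>I. f u = C - m * ln (cos (\<tau> u)) \<and> u = C' + m * \<tau> u"
      by (auto simp: algebra_simps)
    then show ?thesis unfolding \<tau>_def by blast
  qed
qed

text \<open>Conversely, a curve whose height \<open>F\<close> and abscissa \<open>h\<close> satisfy \<open>F' = h' tan\<close> with \<open>h' = s \<noteq> 0\<close>
  has slope \<open>tan \<theta>\<close> at the parameter \<open>\<theta>\<close>. Differentiating the slope gives
  \<open>f'' h' = sec\<^sup>2 \<theta> = 1 + f'\<^sup>2\<close>.\<close>

lemma angle_coordinate_imp_ode:
  fixes f p r h s F :: "real \<Rightarrow> real"
  assumes A: "open A" "A \<subseteq> {-pi/2<..<pi/2}" "\<theta> \<in> A"
    and df: "\<And>t. t \<in> A \<Longrightarrow> (f has_real_derivative p (h t)) (at (h t))"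
    and dp: "(p has_real_derivative r (h \<theta>)) (at (h \<theta>))"
    and dh: "\<And>t. t \<in> A \<Longrightarrow> (h has_real_derivative s t) (at t)"
    and dF: "\<And>t. t \<in> A \<Longrightarrow> (F has_real_derivative s t * tan t) (at t)"
    and s: "\<And>t. t \<in> A \<Longrightarrow> s t \<noteq> 0"
    and eq: "\<And>t. t \<in> A \<Longrightarrow> f (h t) = F t"
  shows "(1 + (p (h \<theta>))\<^sup>2) / r (h \<theta>) = s \<theta>"
proof -
  have tan: "p (h t) = tan t" if "t \<in> A" for t
  proof -
    have "((\<lambda>t. f (h t)) has_real_derivative p (h t) * s t) (at t)"
      by (rule DERIV_chain2[OF df dh]) (use that in auto)
    then have "(F has_real_derivative p (h t) * s t) (at t)"
      using has_field_derivative_transform_within_open[OF _ A(1) that] eq by metis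
    from DERIV_unique[OF this dF[OF that]] s[OF that] show ?thesis by simp
  qed
  have c: "cos \<theta> > 0" using cos_pos_chart A by blast
  have "((\<lambda>t. p (h t)) has_real_derivative r (h \<theta>) * s \<theta>) (at \<theta>)"
    by (rule DERIV_chain2[OF dp dh[OF A(3)]])
  then have "(tan has_real_derivative r (h \<theta>) * s \<theta>) (at \<theta>)"
    using has_field_derivative_transform_within_open[OF _ A(1,3)] tan by metis
  from DERIV_unique[OF this DERIV_tan] c have "r (h \<theta>) * s \<theta> = 1 + (tan \<theta>)\<^sup>2"
    by (simp add: tan_sec power_inverse)
  moreover have "1 + (tan \<theta>)\<^sup>2 > 0" by (simp add: add_pos_nonneg)
  moreover from calculation have "r (h \<theta>) \<noteq> 0" by auto
  ultimately show ?thesis using tan[OF A(3)] by (simp add: nonzero_divide_eq_eq mult.commute)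
qed

section \<open>Separation of variables and angle coordinates on the surface\<close>

text \<open>On a small rectangle around a point of \<open>U\<close> the second variable can be held fixed while the
  first one moves, so the first summand does not change there. It is locally constant on \<open>U\<close>, and
  connectedness does the rest.\<close>

lemma separation_of_variables:
  fixes U :: "(real \<times> real) set" and g1 g2 :: "real \<Rightarrow> real"
  assumes "open U" "connected U" and sum: "\<And>x. x \<in> U \<Longrightarrow> g1 (fst x) + g2 (snd x) = b"
  obtains m where "\<And>u. u \<in> fst ` U \<Longrightarrow> g1 u = m" "\<And>v. v \<in> snd ` U \<Longrightarrow> g2 v = b - m"
proof -
  have "(\<lambda>x. g1 (fst x)) constant_on U"
  proof (rule locally_constant_imp_constant[OF assms(2)])
    fix x assume x: "x \<in> U"
    then obtain A B where AB: "open A" "open B" "x \<in> A \<times> B" "A \<times> B \<subseteq> U"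
      using open_prod_elim[OF assms(1)] by metis
    have "g1 (fst y) = g1 (fst x)" if "y \<in> A \<times> B" for y
    proof -
      have "(fst y, snd x) \<in> U" using that AB by auto
      from sum[OF this] sum[OF x] show ?thesis by simp
    qed
    moreover have "openin (top_of_set U) (A \<times> B)"
      using AB by (simp add: open_Times open_subset)
    ultimately show "\<exists>T. openin (top_of_set U) T \<and> x \<in> T \<and> (\<forall>y\<in>T. g1 (fst y) = g1 (fst x))"
      using AB(3) by blast
  qed
  then obtain m where m: "\<And>x. x \<in> U \<Longrightarrow> g1 (fst x) = m"
    by (auto simp: constant_on_def)
  show ?thesis
  proof (rule that[of m])
    show "g1 u = m" if "u \<in> fst ` U" for u using that m by auto
    show "g2 v = b - m" if "v \<in> snd ` U" for v using that m sum by fastforce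
  qed
qed

text \<open>This excludes vanishing coefficients in a given parametrization: a degenerate coordinate
  would collapse a whole segment of \<open>D\<close> to a point.\<close>

lemma inj_on_product_not_constant:
  fixes D :: "(real \<times> real) set" and h1 h2 :: "real \<Rightarrow> real"
  assumes "open D" "D \<noteq> {}" "inj_on (\<lambda>x. (h1 (fst x), h2 (snd x))) D"
  shows "\<not> (\<forall>t. h1 t = c)" "\<not> (\<forall>t. h2 t = c)"
proof -
  obtain x A B where AB: "open A" "open B" "x \<in> A \<times> B" "A \<times> B \<subseteq> D"
    using open_prod_elim[OF assms(1)] assms(2) by (metis ex_in_conv)
  have "A \<noteq> {fst x}" "B \<noteq> {snd x}"
    using AB not_open_singleton by metis+
  then obtain a' b' where ab: "a' \<in> A" "a' \<noteq> fst x" "b' \<in> B" "b' \<noteq> snd x"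
    using AB(3) by auto
  have D: "(fst x, snd x) \<in> D" "(a', snd x) \<in> D" "(fst x, b') \<in> D"
    using AB ab by auto
  have "h1 (fst x) \<noteq> h1 a'" using inj_onD[OF assms(3), OF _ D(1,2)] ab by (auto simp: prod_eq_iff)
  then show "\<not> (\<forall>t. h1 t = c)" by metis
  have "h2 (snd x) \<noteq> h2 b'" using inj_onD[OF assms(3), OF _ D(1,3)] ab by (auto simp: prod_eq_iff)
  then show "\<not> (\<forall>t. h2 t = c)" by metis
qed

lemma smooth_on_affine:
  fixes g :: "real \<Rightarrow> real"
  assumes "open S" "smooth_on S g"
  shows "smooth_on S (\<lambda>t. C + c * g t)"
  using assms by (auto simp: smooth_on_def intro!: Ck_on_add Ck_on_mult Ck_on_const)

lemma smooth_on_ident: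
  fixes S :: "real set"
  assumes "open S"
  shows "smooth_on S (\<lambda>t. t)"
proof -
  have "Ck_on (Suc k) S (\<lambda>t::real. t)" for k
    by (rule Ck_on_Suc_real[OF assms _ Ck_on_const[OF assms]]) (rule DERIV_ident)
  then show ?thesis unfolding smooth_on_def using Ck_on_SucD by blast
qed

lemma smooth_on_product_map:
  fixes h1 h2 :: "real \<Rightarrow> real"
  assumes "open D" "fst ` D \<subseteq> A" "snd ` D \<subseteq> B" "smooth_on A h1" "smooth_on B h2"
  shows "smooth_on D (\<lambda>x. (h1 (fst x), h2 (snd x)))"
  using assms(4,5) unfolding smooth_on_def
  by (intro allI Ck_on_Pair[OF assms(1)]
      Ck_on_compose_bounded_linear[OF assms(1) bounded_linear_fst assms(2)]
      Ck_on_compose_bounded_linear[OF assms(1) bounded_linear_snd assms(3)]) blast+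

context smooth_translational_surface
begin

text \<open>Slope angles of the two profile curves, the local coordinates of the theorem.\<close>

definition angles :: "real \<times> real \<Rightarrow> real \<times> real" where
  "angles x = (arctan (p (fst x)), arctan (q (snd x)))"

lemma angles_in_chart: "angles ` S \<subseteq> {-pi/2<..<pi/2} \<times> {-pi/2<..<pi/2}"
  using arctan_bounded by (auto simp: angles_def)

lemma smooth_angles: "smooth_on U angles"
  unfolding angles_def[abs_def]
  by (rule smooth_on_product_map[OF open_U order_refl order_refl
        smooth_on_arctan[OF open_fst_U smooth_p] smooth_on_arctan[OF open_snd_U smooth_q]])

text \<open>The normal form of the two profiles says that the product map of \<open>h1\<close> and \<open>h2\<close> is a left
  inverse of \<open>angles\<close>. Hence \<open>angles\<close> is injective, and invariance of domain makes its image
  open.\<close>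

lemma diffeomorphism_angles:
  assumes h: "smooth_on {-pi/2<..<pi/2} h1" "smooth_on {-pi/2<..<pi/2} h2"
    and inv1: "\<And>u. u \<in> fst ` U \<Longrightarrow> h1 (arctan (p u)) = u"
    and inv2: "\<And>v. v \<in> snd ` U \<Longrightarrow> h2 (arctan (q v)) = v"
  shows "diffeomorphism (angles ` U) U (\<lambda>x. (h1 (fst x), h2 (snd x)))"
proof -
  let ?\<psi> = "\<lambda>x. (h1 (fst x), h2 (snd x))"
  have left: "?\<psi> (angles x) = x" if "x \<in> U" for x
    using that inv1[of "fst x"] inv2[of "snd x"] by (simp add: angles_def)
  then have inj: "inj_on angles U" by (metis inj_onI)
  have inj': "inj_on ?\<psi> (angles ` U)"
    by (rule inj_onI) (metis (no_types, lifting) left imageE)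
  have "Ck_on 0 U angles" using smooth_angles unfolding smooth_on_def by blast
  then have op: "open (angles ` U)"
    using invariance_of_domain[OF _ open_U inj] by simp
  have bij: "bij_betw ?\<psi> (angles ` U) U"
    using inj' left by (auto simp: bij_betw_def image_image)
  have "inv_into (angles ` U) ?\<psi> x = angles x" if "x \<in> U" for x
    using inv_into_f_f[OF inj', of "angles x"] left[OF that] that by simp
  then have "smooth_on U (inv_into (angles ` U) ?\<psi>)"
    using smooth_angles Ck_on_cong[OF open_U, of "inv_into (angles ` U) ?\<psi>" angles]
    unfolding smooth_on_def by blast
  moreover have "smooth_on (angles ` U) ?\<psi>"
    by (rule smooth_on_product_map[OF op _ _ h]) (use angles_in_chart[of U] in auto)
  ultimately show ?thesis
    using op open_U bij unfolding diffeomorphism_def by blast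
qed

text \<open>The second and third components of \<open>X\<close> are the parameters \<open>u\<close> and \<open>v\<close>, so the coordinate
  change must be the product of \<open>h1\<close> and \<open>h2\<close>. Freezing one angle on a small rectangle then
  turns the first component into a statement about a single profile, up to an additive
  constant.\<close>

lemma angle_coordinates_imp_ode:
  assumes D: "open D" "D \<subseteq> {-pi/2<..<pi/2} \<times> {-pi/2<..<pi/2}"
    and \<psi>: "\<And>q. q \<in> D \<Longrightarrow> \<psi> q \<in> U"
    and X: "\<And>\<theta> \<phi>. (\<theta>, \<phi>) \<in> D \<Longrightarrow> X (\<psi> (\<theta>, \<phi>)) = vector [F1 \<theta> + F2 \<phi>, h1 \<theta>, h2 \<phi>]"
    and d1: "\<And>t. t \<in> {-pi/2<..<pi/2} \<Longrightarrow> (h1 has_real_derivative s1 t) (at t)"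
      "\<And>t. t \<in> {-pi/2<..<pi/2} \<Longrightarrow> (F1 has_real_derivative s1 t * tan t) (at t)"
      "\<And>t. t \<in> {-pi/2<..<pi/2} \<Longrightarrow> s1 t \<noteq> 0"
    and d2: "\<And>t. t \<in> {-pi/2<..<pi/2} \<Longrightarrow> (h2 has_real_derivative s2 t) (at t)"
      "\<And>t. t \<in> {-pi/2<..<pi/2} \<Longrightarrow> (F2 has_real_derivative s2 t * tan t) (at t)"
      "\<And>t. t \<in> {-pi/2<..<pi/2} \<Longrightarrow> s2 t \<noteq> 0"
    and x: "(\<theta>, \<phi>) \<in> D"
  defines "x \<equiv> \<psi> (\<theta>, \<phi>)"
  shows "(1 + (p (fst x))\<^sup>2) / r (fst x) + (1 + (q (snd x))\<^sup>2) / t (snd x) = s1 \<theta> + s2 \<phi>"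
proof -
  have \<psi>_eq: "\<psi> (\<theta>, \<phi>) = (h1 \<theta>, h2 \<phi>)" and f_eq: "f1 (h1 \<theta>) + f2 (h2 \<phi>) = F1 \<theta> + F2 \<phi>"
    and h_U: "h1 \<theta> \<in> fst ` U" "h2 \<phi> \<in> snd ` U"
    if "(\<theta>, \<phi>) \<in> D" for \<theta> \<phi>
  proof -
    obtain u v where uv: "\<psi> (\<theta>, \<phi>) = (u, v)" by (cases "\<psi> (\<theta>, \<phi>)")
    from X[OF that] have u: "u = h1 \<theta>" and v: "v = h2 \<phi>" and s: "f1 u + f2 v = F1 \<theta> + F2 \<phi>"
      unfolding uv translational_def vec_eq_iff forall_3 vector_3 prod.case by blast+
    show "f1 (h1 \<theta>) + f2 (h2 \<phi>) = F1 \<theta> + F2 \<phi>"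
      using s unfolding u v .
    show "\<psi> (\<theta>, \<phi>) = (h1 \<theta>, h2 \<phi>)"
      using uv unfolding u v .
    then show "h1 \<theta> \<in> fst ` U" "h2 \<phi> \<in> snd ` U"
      using \<psi>[OF that] by force+
  qed
  obtain A B where AB: "open A" "open B" "(\<theta>, \<phi>) \<in> A \<times> B" "A \<times> B \<subseteq> D"
    using open_prod_elim[OF D(1) x] by metis
  have A: "A \<subseteq> {-pi/2<..<pi/2}" and B: "B \<subseteq> {-pi/2<..<pi/2}"
    using AB D(2) by blast+
  have mem: "\<theta> \<in> A" "\<phi> \<in> B" using AB by auto
  have "(1 + (p (h1 \<theta>))\<^sup>2) / r (h1 \<theta>) = s1 \<theta>"
  proof (rule angle_coordinate_imp_ode[OF AB(1) A mem(1),
        where f = f1 and p = p and r = r and h = h1 and s = s1 and F = "\<lambda>t. F1 t + (F2 \<phi> - f2 (h2 \<phi>))"])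
    fix t assume t: "t \<in> A"
    with AB mem have tD: "(t, \<phi>) \<in> D" by auto
    have tI: "t \<in> {-pi/2<..<pi/2}" using t A by blast
    show "(f1 has_real_derivative p (h1 t)) (at (h1 t))"
      by (rule smooth_on_deriv(2)[OF open_fst_U smooth_f1 h_U(1)[OF tD]])
    show "(h1 has_real_derivative s1 t) (at t)" "s1 t \<noteq> 0" using d1 tI by blast+
    show "((\<lambda>t. F1 t + (F2 \<phi> - f2 (h2 \<phi>))) has_real_derivative s1 t * tan t) (at t)"
      using DERIV_add[OF d1(2)[OF tI] DERIV_const] by simp
    show "f1 (h1 t) = F1 t + (F2 \<phi> - f2 (h2 \<phi>))" using f_eq[OF tD] by simp
  next
    show "(p has_real_derivative r (h1 \<theta>)) (at (h1 \<theta>))"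
      by (rule smooth_on_deriv(2)[OF open_fst_U smooth_p h_U(1)[OF x]])
  qed
  moreover have "(1 + (q (h2 \<phi>))\<^sup>2) / t (h2 \<phi>) = s2 \<phi>"
  proof (rule angle_coordinate_imp_ode[OF AB(2) B mem(2),
        where f = f2 and p = q and r = "deriv q" and h = h2 and s = s2
          and F = "\<lambda>t. F2 t + (F1 \<theta> - f1 (h1 \<theta>))"])
    fix t assume t: "t \<in> B"
    with AB mem have tD: "(\<theta>, t) \<in> D" by auto
    have tI: "t \<in> {-pi/2<..<pi/2}" using t B by blast
    show "(f2 has_real_derivative q (h2 t)) (at (h2 t))"
      by (rule smooth_on_deriv(2)[OF open_snd_U smooth_f2 h_U(2)[OF tD]])
    show "(h2 has_real_derivative s2 t) (at t)" "s2 t \<noteq> 0" using d2 tI by blast+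
    show "((\<lambda>t. F2 t + (F1 \<theta> - f1 (h1 \<theta>))) has_real_derivative s2 t * tan t) (at t)"
      using DERIV_add[OF d2(2)[OF tI] DERIV_const] by simp
    show "f2 (h2 t) = F2 t + (F1 \<theta> - f1 (h1 \<theta>))" using f_eq[OF tD] by simp
  next
    show "(q has_real_derivative deriv q (h2 \<phi>)) (at (h2 \<phi>))"
      by (rule smooth_on_deriv(2)[OF open_snd_U smooth_q h_U(2)[OF x]])
  qed
  ultimately show ?thesis by (simp add: x_def \<psi>_eq[OF x])
qed

end

theorem theorem4p2:
  fixes U :: "(real \<times> real) set" and f1 f2 \<Phi> :: "real \<Rightarrow> real" and a b :: real
  assumes "open U" and "connected U"
    and "smooth_on (fst ` U) f1" and "smooth_on (snd ` U) f2"
    and "\<forall>p\<in>U. gauss_curvature (translational f1 f2) p \<noteq> 0"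
    and "\<forall>t\<in>{-pi/2<..<pi/2}. (\<Phi> has_real_derivative sec t powr a) (at t)"
  shows "(\<forall>p\<in>U. angle_fun (translational f1 f2) p * radii_sum (translational f1 f2) p
                 = a * height_fun (translational f1 f2) p + b)
    \<longleftrightarrow>
    (\<exists>D \<psi> C1 C3 C4 C5 C6.
       D \<subseteq> {-pi/2<..<pi/2} \<times> {-pi/2<..<pi/2} \<and>
       given_in_coordinates (translational f1 f2) U \<psi> D
         (\<lambda>(\<theta>, \<phi>).
            if a \<noteq> 0 then
              vector [- b / a + C3 * sec \<theta> powr a + C5 * sec \<phi> powr a,
                      C4 + a * C3 * \<Phi> \<theta>,
                      C6 + a * C5 * \<Phi> \<phi>]
            else
              vector [C3 - C1 * ln (cos \<theta>) - (b - C1) * ln (cos \<phi>),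
                      C4 + C1 * \<theta>,
                      C5 + (b - C1) * \<phi>]))"
    (is "?curv \<longleftrightarrow> ?coord")
proof -
  interpret S: smooth_translational_surface U f1 f2
    using assms(1,3,4) by unfold_locales
  define p q r t where pqrt: "p = deriv f1" "q = deriv f2" "r = deriv p" "t = deriv q"
  have nz: "r (fst x) \<noteq> 0" "t (snd x) \<noteq> 0" if "x \<in> U" for x
    using S.gauss_curvature_nonzero_iff[OF that] assms(5) that by (auto simp: pqrt)
  have height: "height_fun (translational f1 f2) x = f1 (fst x) + f2 (snd x)" for x
    by (cases x) (simp add: height_fun_def translational_def inner_axis)
  have curv: "?curv \<longleftrightarrow> (\<forall>x\<in>U. (1 + (p (fst x))\<^sup>2) / r (fst x) + (1 + (q (snd x))\<^sup>2) / t (snd x)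
      = a * (f1 (fst x) + f2 (snd x)) + b)"
    using S.angle_times_radii_sum nz by (simp add: pqrt height)
  have conn: "connected (fst ` U)" "connected (snd ` U)"
    using assms(2) by (auto intro!: connected_continuous_image continuous_intros)
  show ?thesis
  proof
    assume ?curv
    then have sep: "((1 + (p (fst x))\<^sup>2) / r (fst x) - a * f1 (fst x))
        + ((1 + (q (snd x))\<^sup>2) / t (snd x) - a * f2 (snd x)) = b" if "x \<in> U" for x
      using curv that by (auto simp: algebra_simps)
    from separation_of_variables[OF assms(1,2), of "\<lambda>u. (1 + (p u)\<^sup>2) / r u - a * f1 u"
        "\<lambda>v. (1 + (q v)\<^sup>2) / t v - a * f2 v" b, OF sep]
    obtain m where "\<And>u. u \<in> fst ` U \<Longrightarrow> (1 + (p u)\<^sup>2) / r u - a * f1 u = m"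
      and "\<And>v. v \<in> snd ` U \<Longrightarrow> (1 + (q v)\<^sup>2) / t v - a * f2 v = b - m" by metis
    then have ode1: "\<And>u. u \<in> fst ` U \<Longrightarrow> (1 + (p u)\<^sup>2) / r u = a * f1 u + m"
      and ode2: "\<And>v. v \<in> snd ` U \<Longrightarrow> (1 + (q v)\<^sup>2) / t v = a * f2 v + (b - m)"
      by (auto simp: algebra_simps)
    have d1: "(f1 has_real_derivative p u) (at u)" "(p has_real_derivative r u) (at u)" "r u \<noteq> 0"
      if "u \<in> fst ` U" for u
      using that nz smooth_on_deriv(2)[OF S.open_fst_U] S.smooth_f1 S.smooth_p
      unfolding pqrt by blast+
    have d2: "(f2 has_real_derivative q v) (at v)" "(q has_real_derivative t v) (at v)" "t v \<noteq> 0"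
      if "v \<in> snd ` U" for v
      using that nz smooth_on_deriv(2)[OF S.open_snd_U] S.smooth_f2 S.smooth_q
      unfolding pqrt by blast+
    \<comment> \<open>Both profiles solve the same equation; only the constants \<open>m\<close> and \<open>b - m\<close> differ.\<close>
    note prof1 = profile_in_angle_coordinate[OF S.open_fst_U conn(1) d1 ode1 assms(6)]
    note prof2 = profile_in_angle_coordinate[OF S.open_snd_U conn(2) d2 ode2 assms(6)]
    have sm\<Phi>: "smooth_on {-pi/2<..<pi/2} \<Phi>"
      by (rule smooth_on_sec_powr_antiderivative[OF assms(6)])
    have angles: "fst (S.angles x) = arctan (p (fst x))" "snd (S.angles x) = arctan (q (snd x))" for x
      by (simp_all add: S.angles_def pqrt)
    show ?coord
    proof (cases "a = 0")
      case False
      from prof1(1)[OF _ _ _ _ False] prof2(1)[OF _ _ _ _ False]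
      obtain C3 C4 C5 C6 where
        1: "\<And>u. u \<in> fst ` U \<Longrightarrow> f1 u = - m / a + C3 * sec (arctan (p u)) powr a"
        "\<And>u. u \<in> fst ` U \<Longrightarrow> C4 + a * C3 * \<Phi> (arctan (p u)) = u"
        and 2: "\<And>v. v \<in> snd ` U \<Longrightarrow> f2 v = - (b - m) / a + C5 * sec (arctan (q v)) powr a"
        "\<And>v. v \<in> snd ` U \<Longrightarrow> C6 + a * C5 * \<Phi> (arctan (q v)) = v"
        by metis
      let ?\<psi> = "\<lambda>x. (C4 + a * C3 * \<Phi> (fst x), C6 + a * C5 * \<Phi> (snd x))"
      have "diffeomorphism (S.angles ` U) U ?\<psi>"
        by (rule S.diffeomorphism_angles[OF smooth_on_affine[OF open_greaterThanLessThan sm\<Phi>]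
              smooth_on_affine[OF open_greaterThanLessThan sm\<Phi>]])
           (use 1(2) 2(2) in \<open>simp_all add: pqrt\<close>)
      moreover have "translational f1 f2 (?\<psi> (S.angles x)) =
          vector [- b / a + C3 * sec (fst (S.angles x)) powr a + C5 * sec (snd (S.angles x)) powr a,
                  C4 + a * C3 * \<Phi> (fst (S.angles x)), C6 + a * C5 * \<Phi> (snd (S.angles x))]"
        if "x \<in> U" for x
        using 1[of "fst x"] 2[of "snd x"] that False
        by (simp add: angles translational_def split_beta diff_divide_distrib add_diff_eq diff_add_eq)
      ultimately show ?thesis
        using S.angles_in_chart[of U] False
        by (intro exI[of _ "S.angles ` U"] exI[of _ ?\<psi>] exI[of _ C3] exI[of _ C4] exI[of _ C5]
            exI[of _ C6] conjI) (auto simp: given_in_coordinates_def split_beta)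
    next
      case True
      from prof1(2)[OF _ _ _ _ True] prof2(2)[OF _ _ _ _ True]
      obtain C C4 C' C5 where
        1: "\<And>u. u \<in> fst ` U \<Longrightarrow> f1 u = C - m * ln (cos (arctan (p u)))"
        "\<And>u. u \<in> fst ` U \<Longrightarrow> C4 + m * arctan (p u) = u"
        and 2: "\<And>v. v \<in> snd ` U \<Longrightarrow> f2 v = C' - (b - m) * ln (cos (arctan (q v)))"
        "\<And>v. v \<in> snd ` U \<Longrightarrow> C5 + (b - m) * arctan (q v) = v"
        by metis
      let ?\<psi> = "\<lambda>x. (C4 + m * fst x, C5 + (b - m) * snd x)"
      have "diffeomorphism (S.angles ` U) U ?\<psi>"
        by (rule S.diffeomorphism_angles[OF
              smooth_on_affine[OF open_greaterThanLessThan smooth_on_ident[OF open_greaterThanLessThan]]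
              smooth_on_affine[OF open_greaterThanLessThan smooth_on_ident[OF open_greaterThanLessThan]]])
           (use 1(2) 2(2) in \<open>simp_all add: pqrt\<close>)
      moreover have "translational f1 f2 (?\<psi> (S.angles x)) =
          vector [(C + C') - m * ln (cos (fst (S.angles x))) - (b - m) * ln (cos (snd (S.angles x))),
                  C4 + m * fst (S.angles x), C5 + (b - m) * snd (S.angles x)]"
        if "x \<in> U" for x
        using 1[of "fst x"] 2[of "snd x"] that
        by (simp add: angles translational_def split_beta add_diff_eq diff_add_eq diff_diff_eq add.commute)
      ultimately show ?thesis
        using S.angles_in_chart[of U] True
        by (intro exI[of _ "S.angles ` U"] exI[of _ ?\<psi>] exI[of _ m] exI[of _ "C + C'"]
            exI[of _ C4] exI[of _ C5] exI conjI) (auto simp: given_in_coordinates_def split_beta)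
    qed
  next
    assume ?coord
    then obtain D \<psi> C1 C3 C4 C5 C6 where
      D: "D \<subseteq> {-pi/2<..<pi/2} \<times> {-pi/2<..<pi/2}" and diff: "diffeomorphism D U \<psi>"
      and eq: "\<And>\<theta> \<phi>. (\<theta>, \<phi>) \<in> D \<Longrightarrow> translational f1 f2 (\<psi> (\<theta>, \<phi>)) =
         (if a \<noteq> 0 then
              vector [- b / a + C3 * sec \<theta> powr a + C5 * sec \<phi> powr a,
                      C4 + a * C3 * \<Phi> \<theta>,
                      C6 + a * C5 * \<Phi> \<phi>]
            else
              vector [C3 - C1 * ln (cos \<theta>) - (b - C1) * ln (cos \<phi>),
                      C4 + C1 * \<theta>,
                      C5 + (b - C1) * \<phi>])"
      unfolding given_in_coordinates_def by force
    have opD: "open D" and bij: "bij_betw \<psi> D U"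
      using diff by (auto simp: diffeomorphism_def)
    have \<psi>U: "\<psi> y \<in> U" if "y \<in> D" for y using bij that by (auto simp: bij_betw_def)
    have "(1 + (p (fst x))\<^sup>2) / r (fst x) + (1 + (q (snd x))\<^sup>2) / t (snd x)
      = a * (f1 (fst x) + f2 (snd x)) + b" if "x \<in> U" for x
    proof -
      obtain \<theta> \<phi> where \<theta>\<phi>: "(\<theta>, \<phi>) \<in> D" "x = \<psi> (\<theta>, \<phi>)"
        using bij \<open>x \<in> U\<close> unfolding bij_betw_def by fastforce
      have ne: "D \<noteq> {}" using \<theta>\<phi> by auto
      have first: "translational f1 f2 x $ 1 = f1 (fst x) + f2 (snd x)"
        by (cases x) (simp add: translational_def)
      have inj: "inj_on (\<lambda>y. (h1 (fst y), h2 (snd y))) D"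
        if h: "\<And>\<theta> \<phi>. (\<theta>, \<phi>) \<in> D \<Longrightarrow> \<exists>z. translational f1 f2 (\<psi> (\<theta>, \<phi>)) = vector [z, h1 \<theta>, h2 \<phi>]"
        for h1 h2 :: "real \<Rightarrow> real"
      proof -
        have "\<psi> y = (h1 (fst y), h2 (snd y))" if "y \<in> D" for y
        proof -
          obtain z where "translational f1 f2 (\<psi> y) = vector [z, h1 (fst y), h2 (snd y)]"
            using h[of "fst y" "snd y"] \<open>y \<in> D\<close> by auto
          then show ?thesis
            by (cases "\<psi> y") (simp add: translational_def vec_eq_iff forall_3)
        qed
        then show ?thesis
          using bij by (simp add: bij_betw_def cong: inj_on_cong)
      qed
      show ?thesis
      proof (cases "a = 0")
        case False
        have "inj_on (\<lambda>y. (C4 + a * C3 * \<Phi> (fst y), C6 + a * C5 * \<Phi> (snd y))) D"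
          by (rule inj) (use eq False in auto)
        from inj_on_product_not_constant(1)[OF opD ne this, of C4]
          inj_on_product_not_constant(2)[OF opD ne this, of C6] have C: "C3 \<noteq> 0" "C5 \<noteq> 0" by auto
        have dh: "((\<lambda>t. K + a * C * \<Phi> t) has_real_derivative a * C * sec t powr a) (at t)"
          "((\<lambda>t. K + C * sec t powr a) has_real_derivative a * C * sec t powr a * tan t) (at t)"
          "C \<noteq> 0 \<Longrightarrow> a * C * sec t powr a \<noteq> 0"
          if "t \<in> {-pi/2<..<pi/2}" for t K C
        proof -
          show "((\<lambda>t. K + a * C * \<Phi> t) has_real_derivative a * C * sec t powr a) (at t)"
            using DERIV_add[OF DERIV_const DERIV_cmult[OF assms(6)[rule_format, OF that]]] by simp
          have "((\<lambda>t. K + C * sec t powr a) has_real_derivative 0 + C * (a * tan t * sec t powr a)) (at t)"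
            by (rule DERIV_add[OF DERIV_const DERIV_cmult[OF DERIV_sec_powr[OF that]]])
          then show "((\<lambda>t. K + C * sec t powr a) has_real_derivative a * C * sec t powr a * tan t) (at t)"
            by (simp add: algebra_simps)
          show "a * C * sec t powr a \<noteq> 0" if "C \<noteq> 0"
            using cos_pos_chart[OF \<open>t \<in> _\<close>] that False by (simp add: sec_def)
        qed
        \<comment> \<open>The additive constant of the height is attributed to the first profile.\<close>
        have "(1 + (p (fst x))\<^sup>2) / r (fst x) + (1 + (q (snd x))\<^sup>2) / t (snd x)
            = a * C3 * sec \<theta> powr a + a * C5 * sec \<phi> powr a"
          unfolding pqrt \<theta>\<phi>(2)
          by (rule S.angle_coordinates_imp_ode[OF opD D \<psi>U _
                dh(1)[where K = C4] dh(2)[where K = "- b / a"] dh(3)[OF _ C(1)]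
                dh(1)[where K = C6] dh(2)[where K = 0] dh(3)[OF _ C(2)] \<theta>\<phi>(1)])
             (use eq False in simp_all)
        also have "\<dots> = a * (f1 (fst x) + f2 (snd x)) + b"
          unfolding first[symmetric] using eq[OF \<theta>\<phi>(1)] False
          by (simp add: \<theta>\<phi>(2) algebra_simps)
        finally show ?thesis .
      next
        case True
        have "inj_on (\<lambda>y. (C4 + C1 * fst y, C5 + (b - C1) * snd y)) D"
          by (rule inj) (use eq True in auto)
        from inj_on_product_not_constant(1)[OF opD ne this, of C4]
          inj_on_product_not_constant(2)[OF opD ne this, of C5] have C: "C1 \<noteq> 0" "b - C1 \<noteq> 0" by auto
        have dh: "((\<lambda>t. K + C * t) has_real_derivative C) (at t)"
          "((\<lambda>t. K - C * ln (cos t)) has_real_derivative C * tan t) (at t)"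
          if "t \<in> {-pi/2<..<pi/2}" for t K C :: real
          using cos_pos_chart[OF that]
          by (auto intro!: derivative_eq_intros simp: tan_def)
        have "(1 + (p (fst x))\<^sup>2) / r (fst x) + (1 + (q (snd x))\<^sup>2) / t (snd x) = C1 + (b - C1)"
          unfolding pqrt \<theta>\<phi>(2)
          by (rule S.angle_coordinates_imp_ode[OF opD D \<psi>U _
                dh(1)[where K = C4] dh(2)[where K = C3] C(1)
                dh(1)[where K = C5] dh(2)[where K = 0] C(2) \<theta>\<phi>(1)])
             (use eq True in simp_all)
        then show ?thesis using True by simp
      qed
    qed
    then show ?curv using curv by blast
  qed
qed

end
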